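(* Let $G$ be a finite simple graph on vertex set $\{1,\dots,n\}$ and let $d\le D$. If the framework $(G,\hat{\mathbf{p}})$, $\hat{\mathbf{p}}=(\hat p_1,\dots,\hat p_n)$ with $\hat p_i\in\mathbb{R}^D$, is globally rigid in $\mathbb{R}^D$, and $\mathbf{p}=(p_1,\dots,p_n)$ is obtained by orthogonally projecting each $\hat p_i$ onto a $d$-dimensional linear subspace identified with $\mathbb{R}^d$, then $(G,\mathbf{p})$ is globally rigid in $\mathbb{R}^d$.
   Context: Two frameworks $(G,\mathbf{p})$, $(G,\mathbf{q})$ on the same graph $G=(V,E)$ are equivalent if $\|p_i-p_j\|=\|q_i-q_j\|$ for all edges $ij\in E$, and congruent if $\|p_i-p_j\|=\|q_i-q_j\|$ for all pairs of vertices $i,j$. A framework $(G,\mathbf{p})$ with points in $\mathbb{R}^k$ is globally rigid in $\mathbb{R}^k$ if every framework $(G,\mathbf{q})$ with points in $\mathbb{R}^k$ equivalent to $(G,\mathbf{p})$ is congruent to $(G,\mathbf{p})$. *)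

theory Defs
  imports "HOL-Analysis.Analysis"
begin

definition simple_graph :: "'v set \<Rightarrow> 'v set set \<Rightarrow> bool" where
  "simple_graph V E \<longleftrightarrow> finite V \<and> (\<forall>e\<in>E. e \<subseteq> V \<and> card e = 2)"

text \<open>
  A framework on a graph with vertex set \<open>V\<close> is a configuration \<open>p :: 'v \<Rightarrow> real ^ 'k\<close>, of which
  only the values on \<open>V\<close> are relevant.
\<close>

definition equivalent_frameworks ::
  "'v set set \<Rightarrow> ('v \<Rightarrow> real ^ 'k) \<Rightarrow> ('v \<Rightarrow> real ^ 'k) \<Rightarrow> bool" where
  "equivalent_frameworks E p q \<longleftrightarrow>
     (\<forall>i j. {i, j} \<in> E \<longrightarrow> norm (p i - p j) = norm (q i - q j))"

definition congruent_frameworks ::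
  "'v set \<Rightarrow> ('v \<Rightarrow> real ^ 'k) \<Rightarrow> ('v \<Rightarrow> real ^ 'k) \<Rightarrow> bool" where
  "congruent_frameworks V p q \<longleftrightarrow>
     (\<forall>i\<in>V. \<forall>j\<in>V. norm (p i - p j) = norm (q i - q j))"

text \<open>The ambient dimension is the one of the type of \<open>p\<close>; the competitors \<open>q\<close> live there too.\<close>

definition globally_rigid :: "'v set \<Rightarrow> 'v set set \<Rightarrow> ('v \<Rightarrow> real ^ 'k) \<Rightarrow> bool" where
  "globally_rigid V E p \<longleftrightarrow>
     (\<forall>q :: 'v \<Rightarrow> real ^ 'k. equivalent_frameworks E p q \<longrightarrow> congruent_frameworks V p q)"

definition orthogonal_projection :: "'a::euclidean_space set \<Rightarrow> 'a \<Rightarrow> 'a" where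
  "orthogonal_projection W x = (THE y. y \<in> W \<and> (\<forall>w\<in>W. orthogonal (x - y) w))"

lemma orthogonal_projection_unique_existence:
  fixes W :: "'a::euclidean_space set"
  assumes "subspace W"
  shows "\<exists>!y. y \<in> W \<and> (\<forall>w\<in>W. orthogonal (x - y) w)"
proof -
  obtain y z where yz: "y \<in> span W" "\<And>w. w \<in> span W \<Longrightarrow> orthogonal z w" "x = y + z"
    using orthogonal_subspace_decomp_exists[of W x] by metis
  have W: "span W = W"
    using assms by (simp add: span_eq_iff)
  show ?thesis
  proof (rule ex1I[of _ y])
    show "y \<in> W \<and> (\<forall>w\<in>W. orthogonal (x - y) w)"
      using yz W by simp
  next
    fix u assume u: "u \<in> W \<and> (\<forall>w\<in>W. orthogonal (x - u) w)"
    have uy: "u - y \<in> W"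
      using u yz(1) W assms by (simp add: subspace_diff)
    have "orthogonal (x - u) (u - y)" "orthogonal (x - y) (u - y)"
      using u uy yz W by simp_all
    then have "(u - y) \<bullet> (u - y) = 0"
      by (simp add: orthogonal_def inner_diff_left)
    then show "u = y" by simp
  qed
qed

lemma orthogonal_projection:
  fixes W :: "'a::euclidean_space set"
  assumes "subspace W"
  shows "orthogonal_projection W x \<in> W"
    and "w \<in> W \<Longrightarrow> orthogonal (x - orthogonal_projection W x) w"
  using theI'[OF orthogonal_projection_unique_existence[OF assms, of x]]
  unfolding orthogonal_projection_def by auto

end

theory Submission
  imports Defs
begin

text \<open>
  Replacing the components of \<open>p_hat\<close> in \<open>W\<close> by the points of a competitor \<open>q\<close> of \<open>p\<close>, and keeping
  the components orthogonal to \<open>W\<close>, yields a competitor of \<open>p_hat\<close>. By Pythagoras, a pair of points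
  has equal distances in the two configurations upstairs iff it does downstairs, so global rigidity
  of \<open>p_hat\<close> passes to \<open>p\<close>.
\<close>

theorem theorem3p1:
  fixes n :: nat
    and E :: "nat set set"
    and p_hat :: "nat \<Rightarrow> real ^ 'D"
    and W :: "(real ^ 'D) set"
    and \<iota> :: "real ^ 'd \<Rightarrow> real ^ 'D"
    and p :: "nat \<Rightarrow> real ^ 'd"
  assumes "simple_graph {1..n} E"
    and "CARD('d) \<le> CARD('D)"
    and "globally_rigid {1..n} E p_hat"
    and "subspace W" and "dim W = CARD('d)"
    and "linear \<iota>" and "\<And>x. norm (\<iota> x) = norm x" and "range \<iota> = W"
    and "\<And>i. i \<in> {1..n} \<Longrightarrow> \<iota> (p i) = orthogonal_projection W (p_hat i)"
  shows "globally_rigid {1..n} E p"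
  unfolding globally_rigid_def
proof (intro allI impI)
  fix q :: "nat \<Rightarrow> real ^ 'd"
  assume q: "equivalent_frameworks E p q"
  define r where "r i = p_hat i - orthogonal_projection W (p_hat i)" for i
  define q_hat where "q_hat i = \<iota> (q i) + r i" for i
  \<comment> \<open>The configuration \<open>f\<close> is left free because the identity is needed
    for both \<open>p\<close> and \<open>q\<close>; the second summand does not depend on
    \<open>f\<close>, so it cancels when the two instances are compared.\<close>
  have pythagoras: "(norm ((\<iota> (f i) + r i) - (\<iota> (f j) + r j)))\<^sup>2 = (norm (f i - f j))\<^sup>2 + (norm (r i - r j))\<^sup>2"
    for f :: "nat \<Rightarrow> real ^ 'd" and i j
  proof -
    have "\<iota> (f i - f j) \<in> W"
      using assms(8) by blast
    then have "orthogonal (r i) (\<iota> (f i - f j))" "orthogonal (r j) (\<iota> (f i - f j))"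
      unfolding r_def by (rule orthogonal_projection(2)[OF assms(4)])+
    then have "orthogonal (\<iota> (f i - f j)) (r i - r j)"
      by (simp add: orthogonal_def inner_diff_left inner_commute[of "\<iota> (f i - f j)"])
    moreover have "(\<iota> (f i) + r i) - (\<iota> (f j) + r j) = \<iota> (f i - f j) + (r i - r j)"
      using linear_diff[OF assms(6)] by simp
    ultimately show ?thesis
      using assms(7) norm_add_Pythagorean by metis
  qed
  have same_distance: "norm (p_hat i - p_hat j) = norm (q_hat i - q_hat j) \<longleftrightarrow>
      norm (p i - p j) = norm (q i - q j)"
    if "i \<in> {1..n}" "j \<in> {1..n}" for i j
  proof -
    have "p_hat i = \<iota> (p i) + r i" "p_hat j = \<iota> (p j) + r j"
      using assms(9) that by (simp_all add: r_def)
    then have "(norm (p_hat i - p_hat j))\<^sup>2 = (norm (q_hat i - q_hat j))\<^sup>2 \<longleftrightarrow>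
        (norm (p i - p j))\<^sup>2 = (norm (q i - q j))\<^sup>2"
      using pythagoras[of p i j] pythagoras[of q i j] by (simp add: q_hat_def)
    \<comment> \<open>Norms are nonnegative, so equality of squares is equality of norms.\<close>
    then show ?thesis
      by simp
  qed
  \<comment> \<open>Outside \<open>{1..n}\<close> nothing ties \<open>p\<close> to
    \<open>p_hat\<close>, so \<open>same_distance\<close> reaches an edge only once its endpoints
    are known to be vertices.\<close>
  have "i \<in> {1..n} \<and> j \<in> {1..n}" if "{i, j} \<in> E" for i j
    using assms(1) that unfolding simple_graph_def by blast
  then have "equivalent_frameworks E p_hat q_hat"
    using q same_distance unfolding equivalent_frameworks_def by blast
  then have "congruent_frameworks {1..n} p_hat q_hat"
    using assms(3) unfolding globally_rigid_def by blast
  then show "congruent_frameworks {1..n} p q"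
    using same_distance unfolding congruent_frameworks_def by blast
qed

end
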